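(* For all natural numbers $n \geq 1$ and $m \geq 3$, $\gamma_b(S^n_m) = n + \left\lfloor \frac{m}{2} \right\rfloor$.
   Context: For integers $m \geq 3$ and $n \geq 1$, the $m$-sunlet graph of degree $n$, denoted $S^n_m$, is obtained from the cycle $C_m$ (whose vertices are called base vertices) by attaching to each base vertex $b$ a path of $n$ new vertices $b = u_0, u_1, \dots, u_n$ (edges $u_0u_1,\dots,u_{n-1}u_n$), distinct for different base vertices; so the leaf $u_n$ of each branch is at distance $n$ from its base vertex. For a finite graph $G$ with shortest-path distance $d$, a dominating broadcast function is a function $f: V(G) \to \{0,1,2,\dots\}$ such that every vertex $u$ of $G$ satisfies $d(u,v) \leq f(v)$ for at least one vertex $v$ with $f(v) \geq 1$. The cost of $f$ is $\sum_{v \in V(G)} f(v)$, and $\gamma_b(G)$ is the minimum cost of a dominating broadcast function of $G$. *)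

theory Defs
  imports "Graph_Theory.Graph_Theory"
begin

text \<open>
  Finite simple graphs are the graphs of locale \<^locale>\<open>graph\<close>: each undirected edge is
  represented by its two opposite arcs. With unit weights the library's cheapest-walk
  cost is the usual shortest-path distance; being extended-real valued, it is infinite
  between vertices that are not connected.
\<close>

definition graph_dist :: "('a, 'b) pre_digraph \<Rightarrow> 'a \<Rightarrow> 'a \<Rightarrow> ereal" where
  "graph_dist G u v = wf_digraph.\<mu> G (\<lambda>_. 1) u v"

text \<open>Only the values of a broadcast on the vertices of the graph matter.\<close>

definition dominating_broadcast :: "('a, 'b) pre_digraph \<Rightarrow> ('a \<Rightarrow> nat) \<Rightarrow> bool" where
  "dominating_broadcast G f \<longleftrightarrow>
     (\<forall>u\<in>verts G. \<exists>v\<in>verts G. f v \<ge> 1 \<and> graph_dist G u v \<le> ereal (real (f v)))"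

definition broadcast_cost :: "('a, 'b) pre_digraph \<Rightarrow> ('a \<Rightarrow> nat) \<Rightarrow> nat" where
  "broadcast_cost G f = (\<Sum>v\<in>verts G. f v)"

definition broadcast_domination_number :: "('a, 'b) pre_digraph \<Rightarrow> nat" ("\<gamma>\<^sub>b") where
  "\<gamma>\<^sub>b G = (LEAST c. \<exists>f. dominating_broadcast G f \<and> broadcast_cost G f = c)"

text \<open>
  The vertex \<open>(i, j)\<close> is the vertex at distance \<open>j\<close> from the \<open>i\<close>-th base vertex
  on the branch attached there; the base vertices are the \<open>(i, 0)\<close>.
\<close>

definition sunlet_half_edges :: "nat \<Rightarrow> nat \<Rightarrow> (nat \<times> nat) rel" where
  "sunlet_half_edges m n =
     {((i, 0), ((i + 1) mod m, 0)) | i. i < m} \<union>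
     {((i, j), (i, j + 1)) | i j. i < m \<and> j < n}"

definition sunlet :: "nat \<Rightarrow> nat \<Rightarrow> (nat \<times> nat) pair_pre_digraph" where
  "sunlet m n =
     \<lparr> pverts = {0..<m} \<times> {0..n},
       parcs = sunlet_half_edges m n \<union> (sunlet_half_edges m n)\<inverse> \<rparr>"

lemma pair_graph_sunlet:
  assumes "m \<ge> 3"
  shows "pair_graph (sunlet m n)"
proof
  have sub: "sunlet_half_edges m n \<subseteq> ({0..<m} \<times> {0..n}) \<times> ({0..<m} \<times> {0..n})"
    using assms by (auto simp: sunlet_half_edges_def)
  have "(i + 1) mod m \<noteq> i" if "i < m" for i
    using assms that by (cases "i + 1 = m") auto
  then have irr: "(x, x) \<notin> sunlet_half_edges m n" for x
    by (auto simp: sunlet_half_edges_def)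
  show "fst e \<in> pverts (sunlet m n)" "snd e \<in> pverts (sunlet m n)"
    if "e \<in> parcs (sunlet m n)" for e
    using that sub by (auto simp: sunlet_def)
  show "finite (pverts (sunlet m n))"
    by (simp add: sunlet_def)
  have "finite (sunlet_half_edges m n)"
    using sub by (rule finite_subset) simp
  then show "finite (parcs (sunlet m n))"
    by (simp add: sunlet_def)
  show "fst e \<noteq> snd e" if "e \<in> parcs (sunlet m n)" for e
    using that irr by (cases e) (auto simp: sunlet_def)
  show "symmetric (with_proj (sunlet m n))"
    by (auto simp: symmetric_def sunlet_def sym_def)
qed

end

theory Submission
  imports Defs
begin

text \<open>
  The upper bound is the broadcast of strength \<open>n + m div 2\<close> from one base vertex. The lower
  bound is a fractional packing: with \<open>p = m div 2\<close>, give each leaf weight \<open>2 p\<close>, each base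
  vertex weight \<open>1\<close> and every other vertex weight \<open>2\<close>. Every ball of radius \<open>k \<ge> 1\<close>
  has weight at most \<open>2 m k\<close>, whereas the total weight \<open>2 m (n + p - 1) + m\<close> exceeds
  \<open>2 m (n + p - 1)\<close>, so by integrality every dominating broadcast costs at least \<open>n + p\<close>.
\<close>

section \<open>Graph distance bounded by walks and by potentials\<close>

lemma graph_dist_le_length:
  assumes "wf_digraph G" "pre_digraph.awalk G u p v"
  shows "graph_dist G u v \<le> ereal (real (length p))"
proof -
  interpret wf_digraph G by fact
  have "awalk_cost (\<lambda>_. 1) p = real (length p)"
    by (induction p) auto
  then show ?thesis
    using min_cost_le_walk_cost[OF assms(2), of "\<lambda>_. 1"]
    by (simp add: graph_dist_def)
qed

text \<open>The potential drops by at most 1 per arc, so its total drop is at most the length of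
  every walk. This bounds distances from below without finding shortest walks.\<close>

lemma lipschitz_le_graph_dist:
  fixes \<phi> :: "'a \<Rightarrow> int"
  assumes "wf_digraph G"
    and lip: "\<And>e. e \<in> arcs G \<Longrightarrow> \<phi> (tail G e) \<le> \<phi> (head G e) + 1"
  shows "ereal (real_of_int (\<phi> u - \<phi> v)) \<le> graph_dist G u v"
proof -
  interpret wf_digraph G by fact
  have "real_of_int (\<phi> u - \<phi> v) \<le> awalk_cost (\<lambda>_. 1) p" if "awalk u p v" for p
    using that
  proof (induction p arbitrary: u)
    case Nil
    then show ?case by (simp add: awalk_Nil_iff)
  next
    case (Cons e p)
    then have "e \<in> arcs G" "u = tail G e" "awalk (head G e) p v"
      by (auto simp: awalk_Cons_iff)
    then show ?case
      using Cons.IH[of "head G e"] lip[of e] by simp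
  qed
  then show ?thesis
    unfolding graph_dist_def \<mu>_def by (intro INF_greatest) auto
qed

section \<open>Distances in the sunlet graph\<close>

text \<open>For \<open>c, i < m\<close> this is \<open>(i - c) mod m\<close>, split into cases so
  that no subtraction truncates.\<close>

definition cycle_offset :: "nat \<Rightarrow> nat \<Rightarrow> nat \<Rightarrow> nat" where
  "cycle_offset m c i = (if c \<le> i then i - c else i + m - c)"

text \<open>Equals the distance from \<open>(i, j)\<close> to \<open>(c, l)\<close>; only \<open>\<le>\<close> is needed.\<close>

definition sunlet_potential :: "nat \<Rightarrow> nat \<Rightarrow> nat \<Rightarrow> nat \<times> nat \<Rightarrow> int" where
  "sunlet_potential m c l = (\<lambda>(i, j). let r = cycle_offset m c i in
     if r = 0 then \<bar>int j - int l\<bar> else int j + int l + int (min r (m - r)))"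

text \<open>At level 0 both cases of the potential equal \<open>l + min r (m - r)\<close>, so
  nothing jumps where branch \<open>c\<close> meets the cycle. The absolute value serves both
  orientations of an edge.\<close>

lemma sunlet_potential_lipschitz:
  assumes "m \<ge> 3" "c < m" "(u, v) \<in> sunlet_half_edges m n"
  shows "\<bar>sunlet_potential m c l u - sunlet_potential m c l v\<bar> \<le> 1"
proof -
  consider (cyc) i where "i < m" "u = (i, 0)" "v = ((i + 1) mod m, 0)"
    | (branch) i j where "i < m" "u = (i, j)" "v = (i, j + 1)"
    using assms(3) by (auto simp: sunlet_half_edges_def)
  then show ?thesis
  proof cases
    case cyc
    then consider "i + 1 < m" "(i + 1) mod m = i + 1" | "i = m - 1" "(i + 1) mod m = 0"
      using assms by (cases "i + 1 = m") auto
    then show ?thesis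
      using cyc assms(1,2)
      by cases (auto simp: sunlet_potential_def cycle_offset_def Let_def min_def of_nat_diff)
  next
    case branch
    then show ?thesis
      by (auto simp: sunlet_potential_def Let_def)
  qed
qed

lemma sunlet_potential_le_graph_dist:
  assumes "m \<ge> 3" "c < m"
  shows "ereal (real_of_int (sunlet_potential m c l u)) \<le> graph_dist (sunlet m n) u (c, l)"
proof -
  interpret pair_graph "sunlet m n" using assms by (intro pair_graph_sunlet)
  have "sunlet_potential m c l (tail (sunlet m n) e) \<le> sunlet_potential m c l (head (sunlet m n) e) + 1"
    if "e \<in> arcs (sunlet m n)" for e
    using that sunlet_potential_lipschitz[OF assms, of "fst e" "snd e" n l]
      sunlet_potential_lipschitz[OF assms, of "snd e" "fst e" n l]
    by (cases e) (auto simp: sunlet_def)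
  \<comment> \<open>The potential vanishes at \<open>(c, l)\<close>, so its drop from
    \<open>u\<close> is its value at \<open>u\<close>.\<close>
  from lipschitz_le_graph_dist[OF wf_digraph_axioms this, of u "(c, l)"]
  show ?thesis
    by (simp add: sunlet_potential_def cycle_offset_def)
qed

lemma graph_dist_sunlet_center_le:
  assumes "m \<ge> 3" "u \<in> verts (sunlet m n)"
  shows "graph_dist (sunlet m n) u (0, 0) \<le> ereal (real (n + m div 2))"
proof -
  interpret pair_graph "sunlet m n" using assms by (intro pair_graph_sunlet)
  obtain i j where u: "u = (i, j)" "i < m" "j \<le> n"
    using assms by (auto simp: sunlet_def)
  have step: "\<exists>q. awalk x q (0, 0) \<and> length q = Suc k"
    if "(x, y) \<in> parcs (sunlet m n)" "\<exists>p. awalk y p (0, 0) \<and> length p = k" for x y k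
  proof -
    from that(2) obtain p where "awalk y p (0, 0)" "length p = k" by blast
    with that(1) show ?thesis
      by (intro exI[of _ "(x, y) # p"]) (auto simp: awalk_Cons_iff)
  qed
  have zero: "\<exists>p. awalk (0, 0) p (0, 0) \<and> length p = 0"
  proof -
    have "(0, 0) \<in> pverts (sunlet m n)" using assms by (simp add: sunlet_def)
    then show ?thesis by (auto simp: awalk_Nil_iff)
  qed
  have down: "\<exists>p. awalk (a, 0) p (0, 0) \<and> length p = a" if "a < m" for a
    using that
  proof (induction a)
    case 0
    then show ?case using zero by simp
  next
    case (Suc a)
    show ?case
      by (rule step[of _ "(a, 0)"]) (use Suc in \<open>force simp: sunlet_def sunlet_half_edges_def\<close>)+
  qed
  \<comment> \<open>Indexed by the number of steps less one, so that the induction starts with the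
    arc from \<open>m - 1\<close> that closes the cycle.\<close>
  have up: "\<exists>p. awalk (m - Suc a, 0) p (0, 0) \<and> length p = Suc a" if "a < m" for a
    using that
  proof (induction a)
    case 0
    then have "((m - Suc 0, 0), (0, 0)) \<in> parcs (sunlet m n)"
      by (force simp: sunlet_def sunlet_half_edges_def)
    then show ?case
      by (rule step) (rule zero)
  next
    case (Suc a)
    have "Suc (m - Suc (Suc a)) mod m = m - Suc a"
      using Suc by (simp add: Suc_diff_Suc)
    with Suc have "((m - Suc (Suc a), 0), (m - Suc a, 0)) \<in> parcs (sunlet m n)"
      by (force simp: sunlet_def sunlet_half_edges_def)
    then show ?case
      by (rule step) (use Suc in auto)
  qed
  have base: "\<exists>p. awalk (i, 0) p (0, 0) \<and> length p = min i (m - i)"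
    using down[of i] up[of "m - Suc i"] u by (auto simp: min_def Suc_diff_Suc)
  have "\<exists>p. awalk (i, b) p (0, 0) \<and> length p = b + min i (m - i)" if "b \<le> n" for b
    using that
  proof (induction b)
    case 0
    then show ?case using base by simp
  next
    case (Suc b)
    show ?case
      unfolding add_Suc
      by (rule step[of _ "(i, b)"]) (use u Suc in \<open>auto simp: sunlet_def sunlet_half_edges_def\<close>)
  qed
  then obtain p where p: "awalk (i, j) p (0, 0)" "length p = j + min i (m - i)"
    using u by blast
  have "length p \<le> n + m div 2"
    using p(2) u by (auto simp: min_def)
  then show ?thesis
    using graph_dist_le_length[OF wf_digraph_axioms p(1)] u
    by (auto intro: order_trans)
qed

section \<open>The weight of a ball\<close>

definition level_weight :: "nat \<Rightarrow> nat \<Rightarrow> nat \<Rightarrow> int" where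
  "level_weight n p j = (if j = n then 2 * int p else if j = 0 then 1 else 2)"

text \<open>
  \<open>branch_weight n p x\<close> is the weight of the levels up to \<open>x\<close> of one branch, and
  \<open>cumulative_weight\<close> its sum over all arguments up to \<open>x\<close>. The value at \<open>n\<close> of the
  former assumes \<open>n \<ge> 1\<close>.
\<close>

definition branch_weight :: "nat \<Rightarrow> nat \<Rightarrow> int \<Rightarrow> int" where
  "branch_weight n p x =
     (if x < 0 then 0 else if x < int n then 1 + 2 * x else 2 * int n - 1 + 2 * int p)"

definition cumulative_weight :: "nat \<Rightarrow> nat \<Rightarrow> int \<Rightarrow> int" where
  "cumulative_weight n p x =
     (if x < 0 then 0 else if x < int n then (x + 1)\<^sup>2
      else (int n)\<^sup>2 + (x - int n + 1) * (2 * int n - 1 + 2 * int p))"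

lemma level_weight_nonneg: "level_weight n p j \<ge> 0"
  by (simp add: level_weight_def)

text \<open>Every level weighs at most 2, apart from the excess \<open>2 * p - 2\<close> of the leaf
  level, which is counted at most once.\<close>

lemma sum_level_weight_le_card:
  assumes "p \<ge> 1" "finite A"
  shows "(\<Sum>j\<in>A. level_weight n p j) \<le> 2 * int (card A) + 2 * int p - 2"
proof -
  have "(\<Sum>j\<in>A. level_weight n p j) \<le> (\<Sum>j\<in>A. 2 + (if j = n then 2 * int p - 2 else 0))"
    by (intro sum_mono) (auto simp: level_weight_def)
  also have "\<dots> = 2 * int (card A) + (if n \<in> A then 2 * int p - 2 else 0)"
    using assms by (simp add: sum.distrib)
  also have "\<dots> \<le> 2 * int (card A) + 2 * int p - 2"
    using assms by simp
  finally show ?thesis .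
qed

lemma sum_level_weight_atMost:
  assumes "n \<ge> 1"
  shows "(\<Sum>j | j \<le> n \<and> int j \<le> x. level_weight n p j) = branch_weight n p x"
proof -
  have part: "(\<Sum>j\<le>q. level_weight n p j) = 1 + 2 * int q" if "q < n" for q
    using that by (induction q) (auto simp: level_weight_def)
  have full: "(\<Sum>j\<le>n. level_weight n p j) = 2 * int n - 1 + 2 * int p"
    using assms part[of "n - 1"] by (cases n) (auto simp: level_weight_def)
  consider "x < 0" | "0 \<le> x" "x < int n" | "x \<ge> int n" by linarith
  then show ?thesis
  proof cases
    case 2
    then have "{j. j \<le> n \<and> int j \<le> x} = {..nat x}" by auto
    with 2 part[of "nat x"] show ?thesis by (simp add: branch_weight_def)
  next
    case 3
    then have "{j. j \<le> n \<and> int j \<le> x} = {..n}" by auto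
    with 3 full show ?thesis by (simp add: branch_weight_def)
  qed (auto simp: branch_weight_def)
qed

text \<open>Below \<open>n\<close> the branch weights are the odd numbers, whose partial sums are
  squares; from \<open>n\<close> on they are constant.\<close>

lemma cumulative_weight_diff:
  assumes "n \<ge> 1"
  shows "cumulative_weight n p x - cumulative_weight n p (x - 1) = branch_weight n p x"
proof -
  consider "x < 0" | "x = 0" | "0 < x" "x < int n" | "x = int n" | "x > int n" by linarith
  then show ?thesis
    by cases (use assms in \<open>auto simp: cumulative_weight_def branch_weight_def
      power2_eq_square algebra_simps\<close>)
qed

lemma sum_branch_weight:
  assumes "n \<ge> 1"
  shows "(\<Sum>r<q. branch_weight n p (x - int r)) =
    cumulative_weight n p x - cumulative_weight n p (x - int q)"
proof (induction q)
  case (Suc q)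
  then show ?case
    using cumulative_weight_diff[OF assms, of p "x - int q"] by (simp add: algebra_simps)
qed simp

text \<open>The cyclic distance \<open>min r (m - r)\<close> rises from \<open>0\<close> to
  \<open>p\<close> and then falls from \<open>m - p - 1\<close> to \<open>1\<close>; each of the two
  runs telescopes.\<close>

lemma sum_cyclic_branch_weight:
  assumes "n \<ge> 1" "m \<ge> 1" "p = m div 2"
  shows "(\<Sum>r<m. branch_weight n p (x - int (min r (m - r)))) =
    cumulative_weight n p x + cumulative_weight n p (x - 1)
      - cumulative_weight n p (x - int (m - p)) - cumulative_weight n p (x - int p - 1)"
proof -
  let ?g = "\<lambda>r. branch_weight n p (x - int (min r (m - r)))"
  have shift: "(x - 1) - int (m - p - 1) = x - int (m - p)"
    using assms by linarith
  have "{..<m} = {..<Suc p} \<union> {Suc p..<m}" "{..<Suc p} \<inter> {Suc p..<m} = {}"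
    using assms by auto
  then have "(\<Sum>r<m. ?g r) = (\<Sum>r<Suc p. ?g r) + (\<Sum>r=Suc p..<m. ?g r)"
    by (simp add: sum.union_disjoint del: sum.lessThan_Suc)
  also have "(\<Sum>r<Suc p. ?g r) = (\<Sum>r<Suc p. branch_weight n p (x - int r))"
    using assms by (intro sum.cong) (auto simp: min_def)
  \<comment> \<open>After the reversal the index is the cyclic distance less one, hence
    \<open>x - 1\<close>.\<close>
  also have "(\<Sum>r=Suc p..<m. ?g r) = (\<Sum>r<m - p - 1. branch_weight n p ((x - 1) - int r))"
    by (rule sum.reindex_bij_witness[of _ "\<lambda>r. m - 1 - r" "\<lambda>r. m - 1 - r"])
      (use assms in \<open>auto simp: min_def of_nat_diff algebra_simps\<close>)
  also have "\<dots> = cumulative_weight n p (x - 1) - cumulative_weight n p (x - int (m - p))"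
    unfolding sum_branch_weight[OF assms(1)] shift ..
  finally show ?thesis
    unfolding sum_branch_weight[OF assms(1)] by (simp add: algebra_simps)
qed

text \<open>The weights are tuned to this bound: for even \<open>m\<close> it is an equality at
  \<open>k = n + p - 1\<close>. From \<open>n + p\<close> on, the total weight suffices.\<close>

lemma base_ball_weight_le:
  fixes k :: int
  assumes "n \<ge> 1" "m \<ge> 3" "p = m div 2" "k \<ge> 1"
  shows "(\<Sum>r<m. branch_weight n p (k - int (min r (m - r)))) \<le> 2 * int m * k"
proof (cases "k \<ge> int n + int p")
  case True
  have "(\<Sum>r<m. branch_weight n p (k - int (min r (m - r)))) \<le> (\<Sum>r<m. 2 * (int n + int p))"
    by (intro sum_mono) (auto simp: branch_weight_def)
  also have "\<dots> = 2 * int m * (int n + int p)" by simp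
  also have "\<dots> \<le> 2 * int m * k" using True by (intro mult_left_mono) auto
  finally show ?thesis .
next
  case False
  define N P Q where "N = int n" and "P = int p" and "Q = int (m - p)"
  have b: "N \<ge> 1" "P \<ge> 1" "int m = P + Q" "Q = P \<or> Q = P + 1" "k < N + P"
    using assms False by (auto simp: N_def P_def Q_def of_nat_diff)
  have W: "cumulative_weight n p x = (if x < 0 then 0 else if x < N then (x + 1)\<^sup>2
      else N\<^sup>2 + (x - N + 1) * (2 * N - 1 + 2 * P))" for x
    by (simp add: cumulative_weight_def N_def P_def)
  \<comment> \<open>Since \<open>k < N + P\<close> and \<open>P \<le> Q\<close>, both arguments lie
    below \<open>N\<close>, so only squares occur; an argument \<open>-1\<close> fits too, its
    square being 0.\<close>
  have low: "cumulative_weight n p (k - Q) + cumulative_weight n p (k - P - 1)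
      = (if k < P then 0 else (k - Q + 1)\<^sup>2 + (k - P)\<^sup>2)"
    using b by (auto simp: W)
  have "cumulative_weight n p k + cumulative_weight n p (k - 1) -
    (cumulative_weight n p (k - Q) + cumulative_weight n p (k - P - 1)) \<le> 2 * (P + Q) * k"
  proof (cases "k < N")
    case True
    then have up: "cumulative_weight n p k + cumulative_weight n p (k - 1) = 2 * k\<^sup>2 + 2 * k + 1"
      using assms(4) by (simp add: W power2_eq_square algebra_simps)
    show ?thesis
    proof (cases "k < P")
      case True
      have "(2 * k + 2) * k \<le> (P + Q) * k"
        using True b assms by (intro mult_right_mono) auto
      moreover have "k * k \<ge> 1" using assms(4) mult_mono[of 1 k 1 k] by simp
      ultimately show ?thesis
        unfolding up low using True assms(4) by (simp add: power2_eq_square algebra_simps)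
    next
      case False
      \<comment> \<open>The slack is exactly \<open>P * P + (Q - 1)\<^sup>2 - 1\<close>.\<close>
      have "P * P \<ge> 1" "(Q - 1)\<^sup>2 \<ge> 0" using b mult_mono[of 1 P 1 P] by simp_all
      then show ?thesis
        unfolding up low using False by (simp add: power2_eq_square algebra_simps)
    qed
  next
    case False
    define t where "t = k - N"
    have t: "k = N + t" "t \<ge> 0" using False by (simp_all add: t_def)
    \<comment> \<open>At \<open>t = 0\<close> the second summand is still in the quadratic range,
      but its value \<open>N\<^sup>2\<close> agrees with the linear formula.\<close>
    have up: "cumulative_weight n p k + cumulative_weight n p (k - 1)
        = 2 * N\<^sup>2 + (2 * t + 1) * (2 * N - 1 + 2 * P)"
      using t b(1) by (cases "t = 0") (simp_all add: W power2_eq_square algebra_simps)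
    show ?thesis
    proof (cases "k < P")
      case True
      \<comment> \<open>Lowering \<open>Q\<close> to \<open>P\<close> and then using
        \<open>P \<ge> k + 1\<close> leaves a slack of at least
        \<open>2 * N\<^sup>2 - 1\<close>.\<close>
      have 1: "(N + t + 1) * (2 * N - 1) \<le> P * (2 * N - 1)"
        using True b t by (intro mult_right_mono) auto
      have 2: "P * (N + t) \<le> Q * (N + t)"
        using b t by (intro mult_right_mono) auto
      have 3: "N * N \<ge> 1" using b mult_mono[of 1 N 1 N] by simp
      show ?thesis
        unfolding up low using True 1 2 3 t by (simp add: power2_eq_square algebra_simps)
    next
      case False
      \<comment> \<open>The slack is \<open>2 * (P - t - 1)\<^sup>2\<close> if \<open>Q = P\<close>,
        and \<open>2 * P - 1\<close> more if \<open>Q = P + 1\<close>.\<close>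
      have "(P - t - 1)\<^sup>2 \<ge> 0" by simp
      with b(4) show ?thesis
        unfolding up low unfolding t(1) using False t b(2)
        by (auto simp: power2_eq_square algebra_simps)
    qed
  qed
  moreover have "(\<Sum>r<m. branch_weight n p (k - int (min r (m - r)))) =
    cumulative_weight n p k + cumulative_weight n p (k - 1)
      - cumulative_weight n p (k - Q) - cumulative_weight n p (k - P - 1)"
    unfolding P_def Q_def using assms(1-3) by (intro sum_cyclic_branch_weight) auto
  ultimately show ?thesis unfolding b(3) by linarith
qed

lemma sum_cycle_offset:
  assumes "c < m"
  shows "(\<Sum>i<m. g (cycle_offset m c i)) = (\<Sum>r<m. g r)"
  by (rule sum.reindex_bij_witness[of _ "\<lambda>r. if r + c < m then r + c else r + c - m"
        "cycle_offset m c"])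
    (use assms in \<open>auto simp: cycle_offset_def\<close>)

text \<open>
  A ball of radius \<open>k > l\<close> around \<open>(c, l)\<close> is the ball of radius \<open>k - l\<close> around the base
  vertex, plus the levels in \<open>{k - l<..k + l}\<close> of branch \<open>c\<close>.
\<close>

lemma ball_weight_le:
  assumes "n \<ge> 1" "m \<ge> 3" "p = m div 2" "c < m" "k \<ge> 1"
  shows "(\<Sum>i<m. \<Sum>j | j \<le> n \<and> sunlet_potential m c l (i, j) \<le> int k. level_weight n p j)
    \<le> 2 * int m * int k"
proof -
  let ?w = "level_weight n p"
  define h where "h r = (\<Sum>j | j \<le> n \<and> (if r = 0 then \<bar>int j - int l\<bar>
      else int j + int l + int (min r (m - r))) \<le> int k. ?w j)" for r
  have p: "p \<ge> 1" "int p \<le> int m - 2" "int m \<ge> 3"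
    using assms by (auto simp: of_nat_diff)
  have eq: "(\<Sum>i<m. \<Sum>j | j \<le> n \<and> sunlet_potential m c l (i, j) \<le> int k. ?w j) = (\<Sum>r<m. h r)"
    unfolding sum_cycle_offset[OF assms(4), of h, symmetric]
    by (simp add: h_def sunlet_potential_def Let_def)
  \<comment> \<open>Pays for about \<open>2 * a\<close> levels of one branch, leaf included; it
    rests on \<open>p \<le> m - 2\<close>, which is where \<open>m \<ge> 3\<close> enters.\<close>
  have path: "4 * int a + 2 * int p \<le> 2 * int m * int a" if "a \<ge> 1" for a
  proof -
    have "(int m - 2) * 1 \<le> (int m - 2) * int a"
      using that p by (intro mult_left_mono) auto
    then show ?thesis using p by (simp add: algebra_simps)
  qed
  show ?thesis
  proof (cases "k \<le> l")
    case True
    \<comment> \<open>The ball does not leave branch \<open>c\<close>: every vertex of another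
      branch has potential at least \<open>l + 1\<close>.\<close>
    have "h r = 0" if "r \<in> {..<m} - {0}" for r
    proof -
      have "{j. j \<le> n \<and> (if r = 0 then \<bar>int j - int l\<bar>
        else int j + int l + int (min r (m - r))) \<le> int k} = {}"
        using that True by auto
      then show ?thesis unfolding h_def by (simp only: sum.empty)
    qed
    then have "(\<Sum>r<m. h r) = h 0"
      using assms by (subst sum.remove[of _ 0]) auto
    also have "h 0 \<le> (\<Sum>j\<in>{l - k..l + k}. ?w j)"
      unfolding h_def by (intro sum_mono2) (auto simp: level_weight_nonneg)
    also have "\<dots> \<le> 2 * int (card {l - k..l + k}) + 2 * int p - 2"
      using p by (intro sum_level_weight_le_card) auto
    also have "\<dots> = 4 * int k + 2 * int p" using True by simp
    also have "\<dots> \<le> 2 * int m * int k" using assms by (intro path)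
    finally show ?thesis unfolding eq .
  next
    case False
    define b where "b r = branch_weight n p (int k - int l - int (min r (m - r)))" for r
    have h_eq: "h r = b r" if "r \<noteq> 0" for r
    proof -
      have "{j. j \<le> n \<and> (if r = 0 then \<bar>int j - int l\<bar>
        else int j + int l + int (min r (m - r))) \<le> int k}
        = {j. j \<le> n \<and> int j \<le> int k - int l - int (min r (m - r))}"
        using that by auto
      then show ?thesis
        unfolding h_def b_def using sum_level_weight_atMost[OF assms(1)] by simp
    qed
    have h0: "h 0 \<le> b 0 + 2 * int m * int l"
    proof -
      have "h 0 \<le> (\<Sum>j\<in>{j. j \<le> n \<and> int j \<le> int k - int l} \<union> {k - l<..k + l}. ?w j)"
        unfolding h_def by (intro sum_mono2) (auto simp: level_weight_nonneg)
      also have "\<dots> \<le> (\<Sum>j | j \<le> n \<and> int j \<le> int k - int l. ?w j) + (\<Sum>j\<in>{k - l<..k + l}. ?w j)"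
        by (subst sum.union_disjoint) (use False in auto)
      also have "(\<Sum>j | j \<le> n \<and> int j \<le> int k - int l. ?w j) = b 0"
        unfolding b_def using sum_level_weight_atMost[OF assms(1)] by simp
      \<comment> \<open>The \<open>2 * l\<close> extra levels use up the part \<open>l\<close> of
        the radius; for \<open>l = 0\<close> there are none, and \<open>path\<close> would not
        apply.\<close>
      also have "(\<Sum>j\<in>{k - l<..k + l}. ?w j) \<le> 2 * int m * int l"
      proof (cases "l = 0")
        case False
        have "(\<Sum>j\<in>{k - l<..k + l}. ?w j) \<le> 2 * int (card {k - l<..k + l}) + 2 * int p - 2"
          using p by (intro sum_level_weight_le_card) auto
        also have "\<dots> \<le> 4 * int l + 2 * int p" using \<open>\<not> k \<le> l\<close> by simp
        also have "\<dots> \<le> 2 * int m * int l" using False by (intro path) simp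
        finally show ?thesis .
      qed simp
      finally show ?thesis by simp
    qed
    have "(\<Sum>r<m. h r) = h 0 + (\<Sum>r\<in>{..<m} - {0}. h r)"
      using assms by (subst sum.remove[of _ 0]) auto
    also have "\<dots> \<le> b 0 + 2 * int m * int l + (\<Sum>r\<in>{..<m} - {0}. b r)"
      using h0 h_eq by simp
    also have "\<dots> = (\<Sum>r<m. b r) + 2 * int m * int l"
      using assms by (subst sum.remove[of "{..<m}" 0]) auto
    also have "(\<Sum>r<m. b r) \<le> 2 * int m * (int k - int l)"
      unfolding b_def using False assms by (intro base_ball_weight_le) auto
    finally show ?thesis unfolding eq by (simp add: algebra_simps)
  qed
qed

section \<open>Double counting and the lower bound on the cost\<close>

lemma sum_le_sum_cover:
  fixes w :: "'a \<Rightarrow> int"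
  assumes "finite I" "\<And>i. finite (B i)" "A \<subseteq> (\<Union>i\<in>I. B i)" "\<And>a. w a \<ge> 0"
  shows "sum w A \<le> (\<Sum>i\<in>I. sum w (B i))"
proof -
  have "snd ` Sigma I B = (\<Union>i\<in>I. B i)" by force
  then have "sum w A \<le> sum w (snd ` Sigma I B)"
    using assms by (intro sum_mono2) auto
  also have "\<dots> \<le> (\<Sum>x\<in>Sigma I B. w (snd x))"
    using sum_image_le[of "Sigma I B" w snd] assms by (simp add: o_def)
  also have "\<dots> = (\<Sum>i\<in>I. sum w (B i))"
    using assms by (subst sum.Sigma) (auto simp: case_prod_unfold)
  finally show ?thesis .
qed

lemma dominating_broadcast_cost_ge:
  assumes "n \<ge> 1" "m \<ge> 3" "dominating_broadcast (sunlet m n) f"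
  shows "n + m div 2 \<le> broadcast_cost (sunlet m n) f"
proof -
  define p where "p = m div 2"
  let ?V = "{0..<m} \<times> {0..n}"
  let ?w = "\<lambda>u. level_weight n p (snd u)"
  \<comment> \<open>The potential is at most the distance, so for \<open>f v \<ge> 1\<close> this
    set contains the ball of \<open>v\<close>. It is empty for \<open>f v = 0\<close>, matching the
    zero cost of \<open>v\<close>.\<close>
  define B where "B v = {u \<in> ?V. f v \<ge> 1 \<and>
    sunlet_potential m (fst v) (snd v) u \<le> int (f v)}" for v
  have fin: "finite (B v)" for v unfolding B_def by simp
  have V: "verts (sunlet m n) = ?V" by (simp add: sunlet_def)
  have B: "(\<Sum>u\<in>B v. ?w u) \<le> 2 * int m * int (f v)" if "v \<in> ?V" for v
  proof (cases "f v \<ge> 1")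
    case True
    have "B v = Sigma {..<m} (\<lambda>i. {j. j \<le> n \<and>
        sunlet_potential m (fst v) (snd v) (i, j) \<le> int (f v)})"
      using True by (auto simp: B_def)
    then have "(\<Sum>u\<in>B v. ?w u) = (\<Sum>i<m. \<Sum>j | j \<le> n \<and>
        sunlet_potential m (fst v) (snd v) (i, j) \<le> int (f v). level_weight n p j)"
      by (simp add: sum.Sigma case_prod_unfold)
    then show ?thesis
      using ball_weight_le[OF assms(1,2) p_def _ True, of "fst v" "snd v"] that by auto
  qed (simp add: B_def)
  have cover: "?V \<subseteq> (\<Union>v\<in>?V. B v)"
  proof
    fix u assume u: "u \<in> ?V"
    then obtain v where v: "v \<in> ?V" "f v \<ge> 1"
        "graph_dist (sunlet m n) u v \<le> ereal (real (f v))"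
      using assms(3) unfolding dominating_broadcast_def V by blast
    have "ereal (real_of_int (sunlet_potential m (fst v) (snd v) u)) \<le> ereal (real (f v))"
      using sunlet_potential_le_graph_dist[OF assms(2), of "fst v" "snd v" u n] v
      by (metis SigmaE atLeastLessThan_iff fst_conv order_trans prod.collapse)
    then have "sunlet_potential m (fst v) (snd v) u \<le> int (f v)" by simp
    with u v show "u \<in> (\<Union>v\<in>?V. B v)" unfolding B_def by blast
  qed
  have "(\<Sum>u\<in>?V. ?w u) = (\<Sum>i<m. \<Sum>j | j \<le> n \<and> int j \<le> int n. level_weight n p j)"
    by (simp only: sum.cartesian_product case_prod_unfold) (rule sum.cong; auto)
  also have "\<dots> = int m * (2 * int n - 1 + 2 * int p)"
    unfolding sum_level_weight_atMost[OF assms(1)] by (simp add: branch_weight_def)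
  finally have "int m * (2 * int n - 1 + 2 * int p) = (\<Sum>u\<in>?V. ?w u)" by simp
  also have "\<dots> \<le> (\<Sum>v\<in>?V. \<Sum>u\<in>B v. ?w u)"
    by (rule sum_le_sum_cover[OF _ fin cover level_weight_nonneg]) simp
  also have "\<dots> \<le> (\<Sum>v\<in>?V. 2 * int m * int (f v))"
    using B by (intro sum_mono) auto
  also have "\<dots> = int m * (2 * int (broadcast_cost (sunlet m n) f))"
    by (simp add: broadcast_cost_def V[simplified] sum_distrib_left mult_ac)
  \<comment> \<open>Cancelling \<open>m\<close> leaves an odd number below an even one, so the
    missing 1 is gained by parity.\<close>
  finally have "2 * int n - 1 + 2 * int p \<le> 2 * int (broadcast_cost (sunlet m n) f)"
    using assms(2) by simp
  then show ?thesis by (simp add: p_def)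
qed

theorem theorem4:
  fixes n m :: nat
  assumes "n \<ge> 1" and "m \<ge> 3"
  shows "\<gamma>\<^sub>b (with_proj (sunlet m n)) = n + m div 2"
  unfolding broadcast_domination_number_def
proof (rule Least_equality)
  let ?f = "\<lambda>v :: nat \<times> nat. if v = (0, 0) then n + m div 2 else 0"
  have V: "(0, 0) \<in> verts (sunlet m n)" "finite (verts (sunlet m n))"
    using assms by (auto simp: sunlet_def)
  have "dominating_broadcast (sunlet m n) ?f"
    unfolding dominating_broadcast_def
    using V assms graph_dist_sunlet_center_le[OF assms(2)]
    by (intro ballI bexI[of _ "(0, 0)"]) auto
  moreover have "broadcast_cost (sunlet m n) ?f = n + m div 2"
    unfolding broadcast_cost_def using V by simp
  ultimately show "\<exists>f. dominating_broadcast (sunlet m n) f \<and>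
      broadcast_cost (sunlet m n) f = n + m div 2"
    by blast
next
  fix c
  assume "\<exists>f. dominating_broadcast (sunlet m n) f \<and> broadcast_cost (sunlet m n) f = c"
  then show "n + m div 2 \<le> c"
    using dominating_broadcast_cost_ge[OF assms] by auto
qed

end
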